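(* Let $P$ be a bounded and graded poset. Then \[\underline{H}_P(t)=G_{\sigma(P)}(t)=G_{\tau(P^* )}(t).\]
   Context: All posets are finite, bounded (least element $\widehat 0$, greatest element $\widehat 1$) and graded with rank function $\rho$, $\rho(\widehat 0)=0$; $\rho(P):=\rho(\widehat 1)$. Atoms are elements of rank $1$, coatoms elements of rank $\rho(P)-1$. The truncation $\tau(P)$ is $P$ with all coatoms removed; the dual truncation $\sigma(P)$ is $P$ with all atoms removed. The dual $P^*$ has the same elements with $x\le^* y$ iff $y\le x$ in $P$. Chow polynomial: let $\mu$ be the Möbius function of $P$. For $x\le y$ put $\chi_{[x,y]}(t)=\sum_{x\le z\le y}\mu(x,z)t^{\rho(y)-\rho(z)}$, and define $\overline{\chi}_{[x,x]}(t)=-1$ and $\overline{\chi}_{[x,y]}(t)=\chi_{[x,y]}(t)/(t-1)$ for $x<y$. Define $\underline{H}_{[x,x]}(t)=1$ and, for $x<y$, $\underline{H}_{[x,y]}(t)=\sum_{x<z\le y}\overline{\chi}_{[x,z]}(t)\,\underline{H}_{[z,y]}(t)$. The Chow polynomial is $\underline{H}_P(t):=\underline{H}_{[\widehat0,\widehat1]}(t)$. The (left) augmented Chow polynomial is $G_P(t):=\sum_{z\in P}t^{\rho(z)}\underline{H}_{[z,\widehat1]}(t)$. *)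

theory Defs
  imports "HOL-Computational_Algebra.Polynomial"
begin

text \<open>
  A poset is represented by its (reflexive) order relation \<open>P\<close>: the ground set is \<^term>\<open>Field P\<close>,
  \<open>x \<le> y\<close> is \<open>(x, y) \<in> P\<close>, the dual poset is the converse relation \<open>P\<inverse>\<close>, and the subposet
  induced on \<open>A\<close> is \<open>Restr P A\<close>.
\<close>

definition finite_poset :: "'a rel \<Rightarrow> bool" where
  "finite_poset P \<longleftrightarrow> finite (Field P) \<and> Partial_order P"

definition is_bot :: "'a rel \<Rightarrow> 'a \<Rightarrow> bool" where
  "is_bot P b \<longleftrightarrow> b \<in> Field P \<and> (\<forall>x\<in>Field P. (b, x) \<in> P)"

definition is_top :: "'a rel \<Rightarrow> 'a \<Rightarrow> bool" where
  "is_top P t \<longleftrightarrow> t \<in> Field P \<and> (\<forall>x\<in>Field P. (x, t) \<in> P)"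

definition bot_of :: "'a rel \<Rightarrow> 'a" where
  "bot_of P = (THE b. is_bot P b)"

definition top_of :: "'a rel \<Rightarrow> 'a" where
  "top_of P = (THE t. is_top P t)"

definition interval :: "'a rel \<Rightarrow> 'a \<Rightarrow> 'a \<Rightarrow> 'a set" where
  "interval P x y = {z. (x, z) \<in> P \<and> (z, y) \<in> P}"

definition covered_by :: "'a rel \<Rightarrow> 'a \<Rightarrow> 'a \<Rightarrow> bool" where
  "covered_by P x y \<longleftrightarrow> (x, y) \<in> P \<and> x \<noteq> y \<and> interval P x y = {x, y}"

definition rank_function :: "'a rel \<Rightarrow> ('a \<Rightarrow> nat) \<Rightarrow> bool" where
  "rank_function P \<rho> \<longleftrightarrow>
     (\<forall>b. is_bot P b \<longrightarrow> \<rho> b = 0) \<and> (\<forall>x y. covered_by P x y \<longrightarrow> \<rho> y = \<rho> x + 1)"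

definition bounded_graded_poset :: "'a rel \<Rightarrow> bool" where
  "bounded_graded_poset P \<longleftrightarrow>
     finite_poset P \<and> (\<exists>b. is_bot P b) \<and> (\<exists>t. is_top P t) \<and> (\<exists>\<rho>. rank_function P \<rho>)"

text \<open>
  In a finite poset with a least element, two rank functions agree on \<^term>\<open>Field P\<close>
  (lemma \<open>rank_function_unique\<close> below), so the choice only affects irrelevant values.
\<close>

definition rank_of :: "'a rel \<Rightarrow> 'a \<Rightarrow> nat" where
  "rank_of P = (SOME \<rho>. rank_function P \<rho>)"

lemma finite_interval: "finite_poset P \<Longrightarrow> finite (interval P x y)"
  unfolding finite_poset_def interval_def
  by (rule finite_subset[of _ "Field P"]) (auto simp: Field_def)

lemma interval_psubset:
  assumes "finite_poset P" "(x, y) \<in> P" "z \<in> interval P x y"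
  shows "z \<noteq> y \<Longrightarrow> interval P x z \<subset> interval P x y"
    and "z \<noteq> x \<Longrightarrow> interval P z y \<subset> interval P x y"
proof -
  have tr: "trans P" and an: "antisym P" and re: "refl_on (Field P) P"
    using assms(1) by (auto simp: finite_poset_def order_on_defs)
  have "(x, x) \<in> P" "(y, y) \<in> P"
    using assms(2) re by (auto simp: refl_on_def Field_def)
  then have xy: "x \<in> interval P x y" "y \<in> interval P x y"
    using assms(2) by (auto simp: interval_def)
  have z: "(x, z) \<in> P" "(z, y) \<in> P"
    using assms(3) by (auto simp: interval_def)
  show "interval P x z \<subset> interval P x y" if "z \<noteq> y"
  proof -
    have "y \<notin> interval P x z" using that z an by (auto simp: interval_def antisym_def)
    moreover have "interval P x z \<subseteq> interval P x y"
      using z tr by (auto simp: interval_def dest: transD)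
    ultimately show ?thesis using xy by blast
  qed
  show "interval P z y \<subset> interval P x y" if "z \<noteq> x"
  proof -
    have "x \<notin> interval P z y" using that z an by (auto simp: interval_def antisym_def)
    moreover have "interval P z y \<subseteq> interval P x y"
      using z tr by (auto simp: interval_def dest: transD)
    ultimately show ?thesis using xy by blast
  qed
qed

lemma rank_function_unique:
  assumes "finite_poset P" "is_bot P b" "rank_function P \<rho>" "rank_function P \<rho>'" "x \<in> Field P"
  shows "\<rho> x = \<rho>' x"
  using assms(5)
proof (induction "card (interval P b x)" arbitrary: x rule: less_induct)
  case less
  have bx: "(b, x) \<in> P" using assms(2) less.prems by (auto simp: is_bot_def)
  show ?case
  proof (cases "x = b")
    case True
    then show ?thesis using assms(2-4) by (auto simp: rank_function_def)
  next
    case False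
    define S where "S = interval P b x - {x}"
    have fin: "finite S" unfolding S_def using finite_interval[OF assms(1)] by simp
    have "(b, b) \<in> P" using assms(2) by (auto simp: is_bot_def)
    then have "b \<in> S" using bx False by (auto simp: S_def interval_def)
    then have ne: "(\<lambda>z. card (interval P b z)) ` S \<noteq> {}" by blast
    then have "Max ((\<lambda>z. card (interval P b z)) ` S) \<in> (\<lambda>z. card (interval P b z)) ` S"
      using fin by (intro Max_in) auto
    then obtain y where y: "y \<in> S"
      and "card (interval P b y) = Max ((\<lambda>z. card (interval P b z)) ` S)" by auto
    then have ymax: "card (interval P b z) \<le> card (interval P b y)" if "z \<in> S" for z
      using that fin by (simp add: Max_ge)
    have yx: "(y, x) \<in> P" "y \<noteq> x" "y \<in> interval P b x" using y by (auto simp: S_def interval_def)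
    have yF: "y \<in> Field P" using yx by (auto simp: Field_def)
    have "interval P y x \<subseteq> {y, x}"
    proof
      fix z assume z: "z \<in> interval P y x"
      show "z \<in> {y, x}"
      proof (rule ccontr)
        assume nz: "z \<notin> {y, x}"
        have zF: "z \<in> Field P" using z by (auto simp: interval_def Field_def)
        then have bz: "(b, z) \<in> P" using assms(2) by (auto simp: is_bot_def)
        have "z \<in> S" using nz z bz by (auto simp: S_def interval_def)
        have "y \<in> interval P b z" using z yx by (auto simp: interval_def)
        then have "interval P b y \<subset> interval P b z"
          using interval_psubset(1)[OF assms(1) bz] nz by blast
        then have "card (interval P b y) < card (interval P b z)"
          using finite_interval[OF assms(1)] by (simp add: psubset_card_mono)
        then show False using ymax[OF \<open>z \<in> S\<close>] by simp
      qed
    qed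
    moreover have "(x, x) \<in> P" "(y, y) \<in> P"
      using assms(1) yF less.prems by (auto simp: finite_poset_def order_on_defs refl_on_def)
    ultimately have "covered_by P y x" using yx by (auto simp: covered_by_def interval_def)
    moreover have "\<rho> y = \<rho>' y"
    proof (rule less.hyps[OF _ yF])
      show "card (interval P b y) < card (interval P b x)"
        using interval_psubset(1)[OF assms(1) bx yx(3) yx(2)] finite_interval[OF assms(1)]
        by (simp add: psubset_card_mono)
    qed
    ultimately show ?thesis using assms(3,4) by (auto simp: rank_function_def)
  qed
qed

definition atoms :: "'a rel \<Rightarrow> 'a set" where
  "atoms P = {x \<in> Field P. rank_of P x = 1}"

text \<open>
  The defining condition of coatoms is written additively: with truncated subtraction on
  \<^typ>\<open>nat\<close>, the unique element of a poset of rank 0 would wrongly count as a coatom.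
\<close>

definition coatoms :: "'a rel \<Rightarrow> 'a set" where
  "coatoms P = {x \<in> Field P. rank_of P x + 1 = rank_of P (top_of P)}"

definition truncation :: "'a rel \<Rightarrow> 'a rel" where
  "truncation P = Restr P (Field P - coatoms P)"

definition dual_truncation :: "'a rel \<Rightarrow> 'a rel" where
  "dual_truncation P = Restr P (Field P - atoms P)"

text \<open>
  The guards below only make the recursions total; for a finite poset \<open>P\<close> and \<open>(x, y) \<in> P\<close>
  they are satisfied.
\<close>

function mobius :: "'a rel \<Rightarrow> 'a \<Rightarrow> 'a \<Rightarrow> int" where
  "mobius P x y =
     (if finite_poset P \<and> (x, y) \<in> P
      then if x = y then 1 else - (\<Sum>z\<in>interval P x y - {y}. mobius P x z)
      else 0)"
  by pat_completeness auto
termination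
proof (relation "measure (\<lambda>(P, x, y). card (interval P x y))", goal_cases)
  case (2 P x y z)
  then have "interval P x z \<subset> interval P x y"
    by (intro interval_psubset(1)) auto
  with 2 show ?case by (simp add: finite_interval psubset_card_mono)
qed simp

declare mobius.simps [simp del]

definition chi_poly :: "'a rel \<Rightarrow> 'a \<Rightarrow> 'a \<Rightarrow> int poly" where
  "chi_poly P x y = (\<Sum>z\<in>interval P x y. monom (mobius P x z) (rank_of P y - rank_of P z))"

text \<open>
  For \<open>x < y\<close>, \<open>chi_poly P x y\<close> vanishes at 1, so the division by \<open>t - 1\<close> is exact.
\<close>

definition reduced_chi_poly :: "'a rel \<Rightarrow> 'a \<Rightarrow> 'a \<Rightarrow> int poly" where
  "reduced_chi_poly P x y = (if x = y then - 1 else chi_poly P x y div [:- 1, 1:])"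

function chow_interval :: "'a rel \<Rightarrow> 'a \<Rightarrow> 'a \<Rightarrow> int poly" where
  "chow_interval P x y =
     (if finite_poset P \<and> (x, y) \<in> P
      then if x = y then 1
           else (\<Sum>z\<in>interval P x y - {x}. reduced_chi_poly P x z * chow_interval P z y)
      else 0)"
  by pat_completeness auto
termination
proof (relation "measure (\<lambda>(P, x, y). card (interval P x y))", goal_cases)
  case (2 P x y z)
  then have "interval P z y \<subset> interval P x y"
    by (intro interval_psubset(2)) auto
  with 2 show ?case by (simp add: finite_interval psubset_card_mono)
qed simp

declare chow_interval.simps [simp del]

definition chow_poly :: "'a rel \<Rightarrow> int poly" where
  "chow_poly P = chow_interval P (bot_of P) (top_of P)"

definition augmented_chow_poly :: "'a rel \<Rightarrow> int poly" where
  "augmented_chow_poly P = (\<Sum>z\<in>Field P. monom 1 (rank_of P z) * chow_interval P z (top_of P))"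

end

theory Submission
  imports Defs
begin

text \<open>
  Work in the incidence algebra of \<open>P\<close>, with \<open>\<zeta>\<^sub>t(x,y) = t^(\<rho>(y) - \<rho>(x))\<close>. The reduced
  characteristic polynomials form \<open>\<chi>' = (\<mu> \<zeta>\<^sub>t - t \<delta>) / (t - 1)\<close>, and the recursion defining \<open>H\<close>
  says \<open>\<chi>' H = - \<delta>\<close>. Eliminating \<open>\<mu>\<close> gives \<open>G = \<zeta>\<^sub>t H = t \<zeta> H - (t - 1) \<zeta>\<close>, that is,
  \<open>H = \<zeta> + \<omega> H\<close> for the weight \<open>\<omega>(x,y) = t + t^2 + ... + t^(\<rho>(y) - \<rho>(x) - 1)\<close>.

  The weights \<open>\<omega>(0,z)\<close> vanish for \<open>z = 0\<close> and for the atoms \<open>z\<close>. At every other \<open>z\<close> the weight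
  of \<open>P\<close> exceeds that of \<open>\<sigma>(P)\<close> by the single term \<open>t^(\<rho>(z) - 1)\<close>, which is the coefficient of
  \<open>H(z,1)\<close> in the augmented Chow polynomial of \<open>\<sigma>(P)\<close>, and \<open>H(z,1)\<close> is the same in both posets.
  This is the first equality.

  The weight is invariant under duality, so the transpose \<open>H'\<close> of the function \<open>H\<close> of the dual
  poset satisfies \<open>H' = \<zeta> + H' \<omega>\<close>. Expanding \<open>H' H\<close> in both ways gives \<open>\<zeta> H = H' \<zeta>\<close>. Hence \<open>G\<close>
  is invariant under duality, and the second equality follows from \<open>\<tau>(P\<^sup>*) = \<sigma>(P)\<^sup>*\<close>.
\<close>

section \<open>Finite posets and their incidence algebra\<close>

definition conv :: "'a rel \<Rightarrow> ('a \<Rightarrow> 'a \<Rightarrow> 'b) \<Rightarrow> ('a \<Rightarrow> 'a \<Rightarrow> 'b) \<Rightarrow> 'a \<Rightarrow> 'a \<Rightarrow> 'b::semiring_0" where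
  "conv P f g x y = (\<Sum>z\<in>interval P x y. f x z * g z y)"

definition delta :: "'a \<Rightarrow> 'a \<Rightarrow> 'b::zero_neq_one" where
  "delta x y = of_bool (x = y)"

definition zeta :: "'a \<Rightarrow> 'a \<Rightarrow> 'b::one" where
  "zeta = (\<lambda>_ _. 1)"

lemma interval_converse: "interval (P\<inverse>) y x = interval P x y"
  by (auto simp: interval_def)

lemma covered_by_converse: "covered_by (P\<inverse>) y x \<longleftrightarrow> covered_by P x y"
  by (auto simp: covered_by_def interval_converse)

lemma conv_converse:
  fixes f g :: "'a \<Rightarrow> 'a \<Rightarrow> 'b::comm_semiring_0"
  shows "conv (P\<inverse>) f g y x = conv P (\<lambda>u v. g v u) (\<lambda>u v. f v u) x y"
  by (simp add: conv_def interval_converse mult.commute)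

lemma conv_cong:
  assumes "\<And>z. (x, z) \<in> P \<Longrightarrow> f x z = f' x z" "\<And>z. (z, y) \<in> P \<Longrightarrow> g z y = g' z y"
  shows "conv P f g x y = conv P f' g' x y"
  using assms by (simp add: conv_def interval_def)

lemma conv_add_left: "conv P (\<lambda>u v. f u v + g u v) h x y = conv P f h x y + conv P g h x y"
  by (simp add: conv_def distrib_right sum.distrib)

lemma conv_add_right: "conv P f (\<lambda>u v. g u v + h u v) x y = conv P f g x y + conv P f h x y"
  by (simp add: conv_def distrib_left sum.distrib)

lemma conv_diff_left:
  fixes f g h :: "'a \<Rightarrow> 'a \<Rightarrow> 'b::ring"
  shows "conv P (\<lambda>u v. f u v - g u v) h x y = conv P f h x y - conv P g h x y"
  by (simp add: conv_def left_diff_distrib sum_subtractf)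

lemma conv_diff_right:
  fixes f g h :: "'a \<Rightarrow> 'a \<Rightarrow> 'b::ring"
  shows "conv P f (\<lambda>u v. g u v - h u v) x y = conv P f g x y - conv P f h x y"
  by (simp add: conv_def right_diff_distrib sum_subtractf)

lemma conv_scale_left: "conv P (\<lambda>u v. c * f u v) g x y = c * conv P f g x y"
  by (simp add: conv_def sum_distrib_left mult.assoc)

lemma conv_scale_right:
  fixes f g :: "'a \<Rightarrow> 'a \<Rightarrow> 'b::comm_semiring_0"
  shows "conv P f (\<lambda>u v. c * g u v) x y = c * conv P f g x y"
  by (simp add: conv_def sum_distrib_left mult.left_commute)

locale finite_order =
  fixes P :: "'a rel"
  assumes finite_poset: "finite_poset P"
begin

abbreviation \<mu> :: "'a \<Rightarrow> 'a \<Rightarrow> 'b::ring_1" where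
  "\<mu> x y \<equiv> of_int (mobius P x y)"

lemma finite_Field [simp]: "finite (Field P)"
  using finite_poset by (simp add: finite_poset_def)

lemma finite_interval [simp]: "finite (interval P x y)"
  using finite_poset by (rule Defs.finite_interval)

lemma rel_refl: "x \<in> Field P \<Longrightarrow> (x, x) \<in> P"
  using finite_poset by (auto simp: finite_poset_def order_on_defs refl_on_def)

lemma rel_trans: "(x, y) \<in> P \<Longrightarrow> (y, z) \<in> P \<Longrightarrow> (x, z) \<in> P"
  using finite_poset by (auto simp: finite_poset_def order_on_defs dest: transD)

lemma rel_antisym: "(x, y) \<in> P \<Longrightarrow> (y, x) \<in> P \<Longrightarrow> x = y"
  using finite_poset by (auto simp: finite_poset_def order_on_defs dest: antisymD)

lemma finite_order_converse: "finite_order (P\<inverse>)"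
  using finite_poset by (simp add: finite_order_def finite_poset_def)

lemma endpoints_in_interval:
  assumes "(x, y) \<in> P"
  shows "x \<in> interval P x y" "y \<in> interval P x y"
  using assms by (simp_all add: interval_def rel_refl FieldI1 FieldI2)

lemma interval_self: "x \<in> Field P \<Longrightarrow> interval P x x = {x}"
  by (auto simp: interval_def intro: rel_antisym rel_refl)

lemma card_interval_less:
  assumes "z \<in> interval P x y"
  shows "z \<noteq> y \<Longrightarrow> card (interval P x z) < card (interval P x y)"
    and "z \<noteq> x \<Longrightarrow> card (interval P z y) < card (interval P x y)"
proof -
  have "(x, y) \<in> P" using assms by (auto simp: interval_def intro: rel_trans)
  note psubset = interval_psubset[OF finite_poset this assms]
  show "z \<noteq> y \<Longrightarrow> card (interval P x z) < card (interval P x y)"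
    and "z \<noteq> x \<Longrightarrow> card (interval P z y) < card (interval P x y)"
    using psubset by (simp_all add: psubset_card_mono)
qed

lemma rtranclp_covered_by:
  assumes "(x, y) \<in> P"
  shows "(covered_by P)\<^sup>*\<^sup>* x y"
  using assms
proof (induction "card (interval P x y)" arbitrary: x y rule: less_induct)
  case less
  consider (equal) "x = y" | (cover) "covered_by P x y"
    | (between) z where "z \<in> interval P x y" "z \<noteq> x" "z \<noteq> y"
    using less.prems endpoints_in_interval[OF less.prems] by (auto simp: covered_by_def)
  then show ?case
  proof cases
    case between
    then have "(covered_by P)\<^sup>*\<^sup>* x z" "(covered_by P)\<^sup>*\<^sup>* z y"
      using less.hyps card_interval_less[of z x y] by (auto simp: interval_def)
    then show ?thesis by (rule rtranclp_trans)
  qed auto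
qed

lemma conv_assoc: "conv P (conv P f g) h x y = conv P f (conv P g h) x y"
proof -
  have left: "interval P x z = {w \<in> interval P x y. (w, z) \<in> P}" if "z \<in> interval P x y" for z
    using that by (auto simp: interval_def intro: rel_trans)
  have right: "interval P w y = {z \<in> interval P x y. (w, z) \<in> P}" if "w \<in> interval P x y" for w
    using that by (auto simp: interval_def intro: rel_trans)
  have "conv P (conv P f g) h x y
      = (\<Sum>z\<in>interval P x y. \<Sum>w | w \<in> interval P x y \<and> (w, z) \<in> P. f x w * g w z * h z y)"
    by (simp add: conv_def sum_distrib_right left)
  also have "\<dots> = (\<Sum>w\<in>interval P x y. \<Sum>z | z \<in> interval P x y \<and> (w, z) \<in> P. f x w * g w z * h z y)"
    by (rule sum.swap_restrict) simp_all
  also have "\<dots> = conv P f (conv P g h) x y"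
    by (simp add: conv_def sum_distrib_left mult.assoc right)
  finally show ?thesis .
qed

lemma conv_delta_left:
  fixes g :: "'a \<Rightarrow> 'a \<Rightarrow> 'b::semiring_1"
  assumes "(x, y) \<in> P"
  shows "conv P delta g x y = g x y"
  using endpoints_in_interval[OF assms] by (simp add: conv_def delta_def)

lemma conv_delta_right:
  fixes f :: "'a \<Rightarrow> 'a \<Rightarrow> 'b::semiring_1"
  assumes "(x, y) \<in> P"
  shows "conv P f delta x y = f x y"
  using endpoints_in_interval[OF assms] by (simp add: conv_def delta_def)

lemma conv_left_inverse_eq_right_inverse:
  fixes f g h :: "'a \<Rightarrow> 'a \<Rightarrow> 'b::semiring_1"
  assumes fg: "\<And>u v. (u, v) \<in> P \<Longrightarrow> conv P f g u v = delta u v"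
    and gh: "\<And>u v. (u, v) \<in> P \<Longrightarrow> conv P g h u v = delta u v"
    and "(x, y) \<in> P"
  shows "f x y = h x y"
proof -
  have "f x y = conv P f (conv P g h) x y"
    using assms by (simp add: gh conv_delta_right cong: conv_cong)
  also have "\<dots> = conv P (conv P f g) h x y"
    by (simp add: conv_assoc)
  also have "\<dots> = h x y"
    using assms by (simp add: fg conv_delta_left cong: conv_cong)
  finally show ?thesis .
qed

lemma conv_mobius_zeta:
  assumes "(x, y) \<in> P"
  shows "conv P \<mu> zeta x y = delta x y"
proof -
  have "(\<Sum>z\<in>interval P x y. mobius P x z) = of_bool (x = y)"
  proof (cases "x = y")
    case True
    then show ?thesis
      using assms by (simp add: interval_self FieldI1 mobius.simps finite_poset)
  next
    case False
    then have "mobius P x y = - (\<Sum>z\<in>interval P x y - {y}. mobius P x z)"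
      using assms by (simp add: mobius.simps[of P x y] finite_poset)
    then show ?thesis
      using False endpoints_in_interval[OF assms] by (simp add: sum.remove[of _ y])
  qed
  then show ?thesis
    by (simp add: conv_def zeta_def delta_def flip: of_int_sum)
qed

lemma mobius_converse:
  assumes "(x, y) \<in> P"
  shows "mobius (P\<inverse>) y x = mobius P x y"
proof -
  interpret dual: finite_order "P\<inverse>" by (rule finite_order_converse)
  have zeta_dual: "conv P zeta (\<lambda>u v. mobius (P\<inverse>) v u) u v = delta u v" if "(u, v) \<in> P" for u v
    using dual.conv_mobius_zeta[of v u, where 'b = int] that
    by (simp add: conv_converse zeta_def delta_def eq_commute)
  then show ?thesis
    using conv_left_inverse_eq_right_inverse[OF conv_mobius_zeta zeta_dual assms] by simp
qed

lemma conv_zeta_mobius: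
  assumes "(x, y) \<in> P"
  shows "conv P zeta \<mu> x y = delta x y"
proof -
  interpret dual: finite_order "P\<inverse>" by (rule finite_order_converse)
  have "conv P zeta \<mu> x y = (\<Sum>z\<in>interval P x y. of_int (mobius (P\<inverse>) y z))"
    unfolding conv_def zeta_def by (intro sum.cong) (auto simp: interval_def mobius_converse)
  also have "\<dots> = conv (P\<inverse>) dual.\<mu> zeta y x"
    by (simp add: conv_def zeta_def interval_converse)
  also have "\<dots> = delta x y"
    using assms by (simp add: dual.conv_mobius_zeta delta_def eq_commute)
  finally show ?thesis .
qed

end

section \<open>Chow polynomials of graded posets\<close>

definition graded_zeta :: "'a rel \<Rightarrow> 'a \<Rightarrow> 'a \<Rightarrow> int poly" where
  "graded_zeta P x y = monom 1 (rank_of P y - rank_of P x)"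

definition chow_weight :: "'a rel \<Rightarrow> 'a \<Rightarrow> 'a \<Rightarrow> int poly" where
  "chow_weight P x y = (\<Sum>i=1..<rank_of P y - rank_of P x. monom 1 i)"

definition aug_chow_interval :: "'a rel \<Rightarrow> 'a \<Rightarrow> 'a \<Rightarrow> int poly" where
  "aug_chow_interval P = conv P (graded_zeta P) (chow_interval P)"

lemma geometric_sum_monom:
  assumes "m \<le> n"
  shows "[:- 1, 1:] * (\<Sum>i=m..<n. monom 1 i) = monom 1 n - (monom 1 m :: 'a::comm_ring_1 poly)"
proof -
  have "[:- 1, 1:] * monom 1 i = monom 1 (Suc i) - (monom 1 i :: 'a poly)" for i
    by (simp add: monom_Suc)
  then show ?thesis
    using assms by (simp only: sum_distrib_left sum_Suc_diff')
qed

locale graded_order = finite_order +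
  assumes ex_rank_function: "\<exists>r. rank_function P r"
begin

abbreviation "\<rho> \<equiv> rank_of P"

lemma rank_function_rank_of: "rank_function P \<rho>"
  unfolding rank_of_def using ex_rank_function by (rule someI_ex)

lemma rank_covered_by: "covered_by P x y \<Longrightarrow> \<rho> y = \<rho> x + 1"
  using rank_function_rank_of by (simp add: rank_function_def)

lemma rank_strict_mono:
  assumes "(x, y) \<in> P" "x \<noteq> y"
  shows "\<rho> x < \<rho> y"
proof -
  have "x = y \<or> \<rho> x < \<rho> y"
    using rtranclp_covered_by[OF assms(1)] by induction (auto dest: rank_covered_by)
  then show ?thesis using assms(2) by simp
qed

lemma rank_mono: "(x, y) \<in> P \<Longrightarrow> \<rho> x \<le> \<rho> y"
  using rank_strict_mono[of x y] by (cases "x = y") auto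

lemma graded_zeta_eq:
  assumes "(x, y) \<in> P"
  shows "graded_zeta P x y = [:0, 1:] + [:- 1, 1:] * (chow_weight P x y - delta x y)"
proof (cases "x = y")
  case False
  then have "1 \<le> \<rho> y - \<rho> x"
    using rank_strict_mono[OF assms] by simp
  then have "graded_zeta P x y = monom 1 1 + [:- 1, 1:] * chow_weight P x y"
    unfolding graded_zeta_def chow_weight_def
    by (simp only: geometric_sum_monom add_diff_eq add_diff_cancel_left')
  also have "monom 1 1 = [:0, 1 :: int:]"
    by (simp add: monom_altdef)
  finally show ?thesis
    using False by (simp add: delta_def del: mult_pCons_left)
qed (simp add: graded_zeta_def chow_weight_def delta_def one_pCons)

lemma chi_poly_eq_conv: "chi_poly P x y = conv P \<mu> (graded_zeta P) x y"
  by (simp add: chi_poly_def conv_def graded_zeta_def of_int_poly smult_monom)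

lemma reduced_chi_poly_mult:
  assumes "(x, y) \<in> P"
  shows "[:- 1, 1:] * reduced_chi_poly P x y
    = conv P \<mu> (graded_zeta P) x y - [:0, 1:] * delta x y"
proof (cases "x = y")
  case True
  have "chi_poly P x x = 1"
    using assms True by (simp add: chi_poly_def interval_self FieldI1 mobius.simps finite_poset)
  then show ?thesis
    using True by (simp add: reduced_chi_poly_def delta_def one_pCons flip: chi_poly_eq_conv)
next
  case False
  have "poly (chi_poly P x y) 1 = conv P \<mu> zeta x y"
    by (simp add: chi_poly_def conv_def zeta_def poly_sum poly_monom)
  also have "\<dots> = 0"
    using False conv_mobius_zeta[OF assms, where 'b = int] by (simp add: delta_def)
  finally have "[:- 1, 1:] dvd chi_poly P x y"
    by (simp add: poly_eq_0_iff_dvd)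
  then show ?thesis
    using False by (simp add: reduced_chi_poly_def delta_def dvd_mult_div_cancel
        del: mult_pCons_left flip: chi_poly_eq_conv)
qed

lemma conv_reduced_chi_poly_chow_interval:
  assumes "(x, y) \<in> P"
  shows "conv P (reduced_chi_poly P) (chow_interval P) x y = - delta x y"
proof (cases "x = y")
  case True
  then show ?thesis using assms
    by (simp add: conv_def interval_self FieldI1 reduced_chi_poly_def delta_def
        chow_interval.simps finite_poset)
next
  case False
  have "conv P (reduced_chi_poly P) (chow_interval P) x y = - chow_interval P x y
      + (\<Sum>z\<in>interval P x y - {x}. reduced_chi_poly P x z * chow_interval P z y)"
    using endpoints_in_interval[OF assms] by (simp add: conv_def sum.remove reduced_chi_poly_def)
  then show ?thesis
    using assms False by (simp add: chow_interval.simps[of P x y] finite_poset delta_def)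
qed

lemma conv_mobius_aug_chow_interval:
  assumes "(x, y) \<in> P"
  shows "conv P \<mu> (aug_chow_interval P) x y
    = [:0, 1:] * chow_interval P x y - [:- 1, 1:] * delta x y"
proof -
  have "conv P \<mu> (aug_chow_interval P) x y
      = conv P (conv P \<mu> (graded_zeta P)) (chow_interval P) x y"
    by (simp add: aug_chow_interval_def conv_assoc)
  also have "\<dots> = conv P (\<lambda>u v. [:0, 1:] * delta u v + [:- 1, 1:] * reduced_chi_poly P u v)
      (chow_interval P) x y"
    by (rule conv_cong) (simp_all add: reduced_chi_poly_mult del: mult_pCons_left)
  also have "\<dots> = [:0, 1:] * conv P delta (chow_interval P) x y
      + [:- 1, 1:] * conv P (reduced_chi_poly P) (chow_interval P) x y"
    by (simp only: conv_add_left conv_scale_left)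
  finally show ?thesis
    using assms
    by (simp add: conv_delta_left conv_reduced_chi_poly_chow_interval del: mult_pCons_left)
qed

lemma aug_chow_interval_eq:
  assumes "(x, y) \<in> P"
  shows "aug_chow_interval P x y = [:0, 1:] * conv P zeta (chow_interval P) x y - [:- 1, 1:]"
proof -
  have "aug_chow_interval P x y = conv P (conv P zeta \<mu>) (aug_chow_interval P) x y"
    using assms by (simp add: conv_zeta_mobius conv_delta_left cong: conv_cong)
  also have "\<dots> = conv P zeta (conv P \<mu> (aug_chow_interval P)) x y"
    by (rule conv_assoc)
  also have "\<dots> = conv P zeta (\<lambda>u v. [:0, 1:] * chow_interval P u v - [:- 1, 1:] * delta u v) x y"
    by (rule conv_cong) (simp_all only: conv_mobius_aug_chow_interval)
  also have "\<dots> = [:0, 1:] * conv P zeta (chow_interval P) x y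
      - [:- 1, 1:] * conv P zeta delta x y"
    by (simp only: conv_diff_right conv_scale_right)
  finally show ?thesis
    using assms by (simp add: conv_delta_right zeta_def del: mult_pCons_left)
qed

lemma chow_interval_recursion:
  assumes "(x, y) \<in> P"
  shows "chow_interval P x y = 1 + conv P (chow_weight P) (chow_interval P) x y"
proof -
  let ?H = "chow_interval P"
  have "aug_chow_interval P x y
      = conv P (\<lambda>u v. [:0, 1:] * zeta u v + [:- 1, 1:] * (chow_weight P u v - delta u v)) ?H x y"
    unfolding aug_chow_interval_def
    by (rule conv_cong) (simp_all only: graded_zeta_eq zeta_def mult_1_right)
  also have "\<dots> = [:0, 1:] * conv P zeta ?H x y
      + [:- 1, 1:] * (conv P (chow_weight P) ?H x y - conv P delta ?H x y)"
    by (simp only: conv_add_left conv_scale_left conv_diff_left)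
  finally have "[:- 1, 1:] * (conv P (chow_weight P) ?H x y - ?H x y) = [:- 1, 1:] * - 1"
    using assms by (simp add: aug_chow_interval_eq conv_delta_left del: mult_pCons_left)
  then have "conv P (chow_weight P) ?H x y - ?H x y = - 1"
    by (subst (asm) mult_cancel_left) simp
  then show ?thesis by (simp add: algebra_simps)
qed

lemma graded_order_converse: "graded_order (P\<inverse>)"
proof (intro graded_order.intro graded_order_axioms.intro exI)
  let ?m = "Max (\<rho> ` Field P)"
  show "rank_function (P\<inverse>) (\<lambda>x. ?m - \<rho> x)"
    unfolding rank_function_def
  proof (intro conjI allI impI)
    fix t assume "is_bot (P\<inverse>) t"
    then have "?m \<le> \<rho> t" by (intro Max.boundedI) (auto simp: is_bot_def intro: rank_mono)
    then show "?m - \<rho> t = 0" by simp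
  next
    fix x y assume "covered_by (P\<inverse>) x y"
    then have "covered_by P y x"
      by (simp add: covered_by_converse)
    moreover from this have "x \<in> Field P"
      unfolding covered_by_def by (blast intro: FieldI2)
    ultimately have "\<rho> x = \<rho> y + 1" "\<rho> x \<le> ?m"
      by (blast intro: rank_covered_by, simp)
    then show "?m - \<rho> y = ?m - \<rho> x + 1" by simp
  qed
qed (rule finite_order_converse)

lemma rank_add_rank_converse:
  assumes "(x, y) \<in> P"
  shows "\<rho> y + rank_of (P\<inverse>) y = \<rho> x + rank_of (P\<inverse>) x"
  using rtranclp_covered_by[OF assms]
proof induction
  case (step y z)
  then have "covered_by (P\<inverse>) z y"
    by (simp add: covered_by_converse)
  then show ?case
    using step graded_order.rank_covered_by[OF graded_order_converse, of z y]
      rank_covered_by[of y z]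
    by simp
qed simp

lemma chow_weight_converse:
  assumes "(x, y) \<in> P"
  shows "chow_weight (P\<inverse>) y x = chow_weight P x y"
proof -
  have "rank_of (P\<inverse>) x - rank_of (P\<inverse>) y = \<rho> y - \<rho> x"
    using rank_add_rank_converse[OF assms] rank_mono[OF assms] by linarith
  then show ?thesis by (simp add: chow_weight_def)
qed

lemma conv_zeta_chow_interval_converse:
  assumes "(x, y) \<in> P"
  shows "conv (P\<inverse>) zeta (chow_interval (P\<inverse>)) y x = conv P zeta (chow_interval P) x y"
proof -
  interpret dual: graded_order "P\<inverse>" by (rule graded_order_converse)
  let ?H = "chow_interval P" and ?w = "chow_weight P"
  define H' where "H' = (\<lambda>u v. chow_interval (P\<inverse>) v u)"
  have dual_recursion: "H' u v = zeta u v + conv P H' ?w u v" if "(u, v) \<in> P" for u v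
  proof -
    have "H' u v = 1 + conv P H' (\<lambda>u v. chow_weight (P\<inverse>) v u) u v"
      using that dual.chow_interval_recursion[of v u] by (simp add: H'_def conv_converse)
    then show ?thesis
      by (simp add: zeta_def chow_weight_converse cong: conv_cong)
  qed
  have "conv P H' zeta x y + conv P H' (conv P ?w ?H) x y
      = conv P H' (\<lambda>u v. zeta u v + conv P ?w ?H u v) x y"
    by (simp only: conv_add_right)
  also have "\<dots> = conv P H' ?H x y"
    by (rule conv_cong) (simp_all add: zeta_def flip: chow_interval_recursion)
  also have "\<dots> = conv P (\<lambda>u v. zeta u v + conv P H' ?w u v) ?H x y"
    by (rule conv_cong) (simp_all add: dual_recursion)
  also have "\<dots> = conv P zeta ?H x y + conv P (conv P H' ?w) ?H x y"
    by (simp only: conv_add_left)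
  finally have "conv P H' zeta x y = conv P zeta ?H x y"
    by (simp add: conv_assoc)
  then show ?thesis by (simp add: conv_converse H'_def zeta_def)
qed

lemma aug_chow_interval_converse:
  assumes "(x, y) \<in> P"
  shows "aug_chow_interval (P\<inverse>) y x = aug_chow_interval P x y"
  using assms graded_order.aug_chow_interval_eq[OF graded_order_converse, of y x]
  by (simp add: aug_chow_interval_eq conv_zeta_chow_interval_converse)

end

section \<open>Bounded posets and truncation\<close>

lemma is_bot_converse: "is_bot (P\<inverse>) = is_top P"
  and is_top_converse: "is_top (P\<inverse>) = is_bot P"
  by (auto simp: is_bot_def is_top_def fun_eq_iff)

lemma bot_of_converse: "bot_of (P\<inverse>) = top_of P"
  and top_of_converse: "top_of (P\<inverse>) = bot_of P"
  by (simp_all add: bot_of_def top_of_def is_bot_converse is_top_converse)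

locale bounded_graded_order = graded_order +
  assumes ex_bot: "\<exists>b. is_bot P b" and ex_top: "\<exists>t. is_top P t"

lemma bounded_graded_order_iff: "bounded_graded_order P \<longleftrightarrow> bounded_graded_poset P"
  by (auto simp: bounded_graded_order_def bounded_graded_order_axioms_def graded_order_def
      graded_order_axioms_def finite_order_def bounded_graded_poset_def)

context bounded_graded_order
begin

lemma bot_of_eq: "is_bot P b \<Longrightarrow> bot_of P = b"
  unfolding bot_of_def by (rule the_equality) (auto simp: is_bot_def intro: rel_antisym)

lemma top_of_eq: "is_top P t \<Longrightarrow> top_of P = t"
  unfolding top_of_def by (rule the_equality) (auto simp: is_top_def intro: rel_antisym)

lemma is_bot_bot_of: "is_bot P (bot_of P)"
  using ex_bot bot_of_eq by auto

lemma is_top_top_of: "is_top P (top_of P)"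
  using ex_top top_of_eq by auto

lemma bot_in_Field [simp]: "bot_of P \<in> Field P"
  and bot_least: "x \<in> Field P \<Longrightarrow> (bot_of P, x) \<in> P"
  using is_bot_bot_of by (auto simp: is_bot_def)

lemma top_in_Field [simp]: "top_of P \<in> Field P"
  and top_greatest: "x \<in> Field P \<Longrightarrow> (x, top_of P) \<in> P"
  using is_top_top_of by (auto simp: is_top_def)

lemma interval_bot_top: "interval P (bot_of P) (top_of P) = Field P"
  by (auto simp: interval_def bot_least top_greatest intro: FieldI1)

lemma rank_of_eq: "rank_function P r \<Longrightarrow> x \<in> Field P \<Longrightarrow> \<rho> x = r x"
  using rank_function_unique[OF finite_poset is_bot_bot_of rank_function_rank_of] .

lemma rank_bot [simp]: "\<rho> (bot_of P) = 0"
  using rank_function_rank_of is_bot_bot_of by (auto simp: rank_function_def)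

lemma rank_eq_0_iff: "x \<in> Field P \<Longrightarrow> \<rho> x = 0 \<longleftrightarrow> x = bot_of P"
  using rank_strict_mono[OF bot_least, of x] by fastforce

lemma bounded_graded_order_converse: "bounded_graded_order (P\<inverse>)"
  using graded_order_converse ex_bot ex_top
  by (simp add: bounded_graded_order_def bounded_graded_order_axioms_def
      is_bot_converse is_top_converse)

lemma augmented_chow_poly_eq: "augmented_chow_poly P = aug_chow_interval P (bot_of P) (top_of P)"
  by (simp add: augmented_chow_poly_def aug_chow_interval_def conv_def
      graded_zeta_def interval_bot_top)

lemma augmented_chow_poly_converse: "augmented_chow_poly (P\<inverse>) = augmented_chow_poly P"
  by (simp add: augmented_chow_poly_eq bot_of_converse top_of_converse aug_chow_interval_converse
      bot_least bounded_graded_order.augmented_chow_poly_eq[OF bounded_graded_order_converse])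

lemma chow_poly_recursion:
  "chow_poly P = 1 + (\<Sum>z\<in>Field P. chow_weight P (bot_of P) z * chow_interval P z (top_of P))"
  unfolding chow_poly_def
  by (simp add: chow_interval_recursion[OF bot_least] conv_def interval_bot_top)

lemma coatoms_converse: "coatoms (P\<inverse>) = atoms P"
proof -
  have "rank_of (P\<inverse>) x + 1 = rank_of (P\<inverse>) (bot_of P) \<longleftrightarrow> \<rho> x = 1" if "x \<in> Field P" for x
    using rank_add_rank_converse[OF bot_least[OF that]] by auto
  then show ?thesis by (auto simp: coatoms_def atoms_def top_of_converse)
qed

lemma truncation_converse: "truncation (P\<inverse>) = (dual_truncation P)\<inverse>"
  by (auto simp: truncation_def dual_truncation_def coatoms_converse)

abbreviation "P\<^sub>\<sigma> \<equiv> dual_truncation P"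

lemma Field_dual_truncation: "Field P\<^sub>\<sigma> = Field P - atoms P"
  using rel_refl by (auto simp: dual_truncation_def Field_def)

lemma dual_truncation_iff: "(x, y) \<in> P\<^sub>\<sigma> \<longleftrightarrow> (x, y) \<in> P \<and> x \<notin> atoms P \<and> y \<notin> atoms P"
  by (auto simp: dual_truncation_def Field_def)

lemma dual_truncation_rank_ge_2: "x \<in> Field P\<^sub>\<sigma> \<Longrightarrow> x \<noteq> bot_of P \<Longrightarrow> \<rho> x \<ge> 2"
  using rank_eq_0_iff[of x] by (auto simp: Field_dual_truncation atoms_def)

lemma is_bot_dual_truncation: "is_bot P\<^sub>\<sigma> (bot_of P)"
  by (auto simp: is_bot_def Field_dual_truncation dual_truncation_iff bot_least atoms_def)

lemma is_top_dual_truncation: "is_top P\<^sub>\<sigma> (if top_of P \<in> atoms P then bot_of P else top_of P)"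
proof (cases "top_of P \<in> atoms P")
  case True
  have "x = bot_of P" if "x \<in> Field P\<^sub>\<sigma>" for x
  proof (rule ccontr)
    assume "x \<noteq> bot_of P"
    then have "2 \<le> \<rho> x" using that by (rule dual_truncation_rank_ge_2[rotated])
    also have "\<rho> x \<le> \<rho> (top_of P)"
      using that by (intro rank_mono top_greatest) (simp add: Field_dual_truncation)
    finally show False using True by (simp add: atoms_def)
  qed
  then show ?thesis using True is_bot_dual_truncation by (auto simp: is_top_def is_bot_def)
next
  case False
  then show ?thesis
    by (auto simp: is_top_def Field_dual_truncation dual_truncation_iff top_greatest)
qed

lemma finite_poset_dual_truncation: "finite_poset P\<^sub>\<sigma>"
  unfolding finite_poset_def partial_order_on_def preorder_on_def
proof (intro conjI)
  show "finite (Field P\<^sub>\<sigma>)" by (simp add: Field_dual_truncation)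
  show "refl_on (Field P\<^sub>\<sigma>) P\<^sub>\<sigma>"
    by (auto simp: refl_on_def Field_dual_truncation dual_truncation_iff rel_refl)
  show "trans P\<^sub>\<sigma>"
    by (auto simp: trans_def dual_truncation_iff intro: rel_trans)
  show "antisym P\<^sub>\<sigma>"
    by (auto simp: antisym_def dual_truncation_iff intro: rel_antisym)
qed (auto simp: Field_def)

lemma dual_truncation_above:
  assumes "x \<in> Field P\<^sub>\<sigma>" "x \<noteq> bot_of P" "(x, z) \<in> P"
  shows "z \<in> Field P\<^sub>\<sigma>" "z \<noteq> bot_of P"
  using dual_truncation_rank_ge_2[OF assms(1,2)] rank_mono[OF assms(3)] assms(3)
  by (auto simp: Field_dual_truncation atoms_def FieldI2)

lemma interval_dual_truncation:
  assumes "x \<in> Field P\<^sub>\<sigma>" "x \<noteq> bot_of P"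
  shows "interval P\<^sub>\<sigma> x y = interval P x y"
  using assms dual_truncation_above[OF assms] rel_trans[of x _ y]
  by (auto simp: interval_def dual_truncation_iff Field_dual_truncation)

lemma rank_function_dual_truncation: "rank_function P\<^sub>\<sigma> (\<lambda>x. \<rho> x - 1)"
  unfolding rank_function_def
proof (intro conjI allI impI)
  fix b assume "is_bot P\<^sub>\<sigma> b"
  then have "b = bot_of P"
    using is_bot_dual_truncation by (auto simp: is_bot_def dual_truncation_iff intro: rel_antisym)
  then show "\<rho> b - 1 = 0" by simp
next
  fix x y assume "covered_by P\<^sub>\<sigma> x y"
  then have less: "(x, y) \<in> P" "x \<noteq> y" and mem: "x \<in> Field P\<^sub>\<sigma>" "y \<in> Field P\<^sub>\<sigma>"
    and cover: "interval P\<^sub>\<sigma> x y = {x, y}"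
    by (auto simp: covered_by_def dual_truncation_iff Field_def)
  have y_not_bot: "y \<noteq> bot_of P" "y \<in> Field P"
    using mem rank_strict_mono[OF less] by (auto simp: Field_dual_truncation)
  show "\<rho> y - 1 = \<rho> x - 1 + 1"
  proof (cases "x = bot_of P")
    case True
    obtain w where w_cover: "covered_by P w y"
      using rtranclp_covered_by[OF bot_least[OF y_not_bot(2)]] y_not_bot(1)
      by (auto elim: rtranclp.cases)
    then have w_less: "(w, y) \<in> P" "w \<noteq> y" and w_mem: "w \<in> Field P"
      by (auto simp: covered_by_def Field_def)
    have "w \<in> interval P\<^sub>\<sigma> x y" if "w \<notin> atoms P"
      using that w_less w_mem mem True
      by (simp add: interval_def dual_truncation_iff Field_dual_truncation bot_least)
    then have "w = bot_of P \<or> w \<in> atoms P"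
      using w_less(2) cover True by blast
    then have "\<rho> w \<le> 1" by (auto simp: atoms_def)
    then show ?thesis
      using rank_covered_by[OF w_cover] dual_truncation_rank_ge_2[OF mem(2) y_not_bot(1)] True
      by simp
  next
    case False
    then have "covered_by P x y"
      using less cover interval_dual_truncation[OF mem(1) False] by (simp add: covered_by_def)
    from rank_covered_by[OF this] show ?thesis
      using dual_truncation_rank_ge_2[OF mem(1) False] by simp
  qed
qed

lemma bounded_graded_order_dual_truncation: "bounded_graded_order P\<^sub>\<sigma>"
  unfolding bounded_graded_order_iff bounded_graded_poset_def
  using finite_poset_dual_truncation is_bot_dual_truncation is_top_dual_truncation
    rank_function_dual_truncation by blast

lemma bot_of_dual_truncation: "bot_of P\<^sub>\<sigma> = bot_of P"
  using bounded_graded_order.bot_of_eq[OF bounded_graded_order_dual_truncation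
      is_bot_dual_truncation] .

lemma top_of_dual_truncation: "top_of P\<^sub>\<sigma> = (if top_of P \<in> atoms P then bot_of P else top_of P)"
  using bounded_graded_order.top_of_eq[OF bounded_graded_order_dual_truncation
      is_top_dual_truncation] .

lemma rank_of_dual_truncation: "x \<in> Field P\<^sub>\<sigma> \<Longrightarrow> rank_of P\<^sub>\<sigma> x = \<rho> x - 1"
  using bounded_graded_order.rank_of_eq[OF bounded_graded_order_dual_truncation
      rank_function_dual_truncation] .

lemma chow_interval_dual_truncation:
  assumes "x \<in> Field P\<^sub>\<sigma>" "x \<noteq> bot_of P" "(x, y) \<in> P"
  shows "chow_interval P\<^sub>\<sigma> x y = chow_interval P x y"
  using assms
proof (induction "card (interval P x y)" arbitrary: x rule: less_induct)
  case less
  interpret \<sigma>: bounded_graded_order P\<^sub>\<sigma> by (rule bounded_graded_order_dual_truncation)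
  have weighted: "chow_weight P\<^sub>\<sigma> x z * chow_interval P\<^sub>\<sigma> z y
      = chow_weight P x z * chow_interval P z y"
    if z: "z \<in> interval P x y" for z
  proof (cases "z = x")
    case False
    have above: "z \<in> Field P\<^sub>\<sigma>" "z \<noteq> bot_of P"
      using dual_truncation_above[OF less.prems(1,2), of z] z by (auto simp: interval_def)
    then have "rank_of P\<^sub>\<sigma> z - rank_of P\<^sub>\<sigma> x = \<rho> z - \<rho> x"
      using less.prems dual_truncation_rank_ge_2[of x] by (simp add: rank_of_dual_truncation)
    moreover have "chow_interval P\<^sub>\<sigma> z y = chow_interval P z y"
      using less.hyps card_interval_less(2)[OF z False] above z by (simp add: interval_def)
    ultimately show ?thesis by (simp add: chow_weight_def)
  qed (simp add: chow_weight_def)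
  have "(x, y) \<in> P\<^sub>\<sigma>"
    using dual_truncation_above[OF less.prems] less.prems
    by (simp add: dual_truncation_iff Field_dual_truncation)
  then have "chow_interval P\<^sub>\<sigma> x y
      = 1 + (\<Sum>z\<in>interval P x y. chow_weight P\<^sub>\<sigma> x z * chow_interval P\<^sub>\<sigma> z y)"
    using \<sigma>.chow_interval_recursion less.prems by (simp add: conv_def interval_dual_truncation)
  also have "\<dots> = chow_interval P x y"
    using less.prems by (simp add: chow_interval_recursion conv_def weighted)
  finally show ?case .
qed

lemma chow_weight_bot_eq_0:
  assumes "z \<notin> Field P\<^sub>\<sigma> - {bot_of P}" "z \<in> Field P"
  shows "chow_weight P (bot_of P) z = 0"
proof -
  have "\<rho> z \<le> 1"
    using assms by (auto simp: Field_dual_truncation atoms_def)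
  then show ?thesis by (simp add: chow_weight_def)
qed

lemma chow_weight_bot_dual_truncation:
  assumes "z \<in> Field P\<^sub>\<sigma>" "z \<noteq> bot_of P"
  shows "chow_weight P (bot_of P) z = chow_weight P\<^sub>\<sigma> (bot_of P) z + monom 1 (rank_of P\<^sub>\<sigma> z)"
proof -
  have "rank_of P\<^sub>\<sigma> (bot_of P) = 0"
    using is_bot_dual_truncation by (simp add: rank_of_dual_truncation is_bot_def)
  moreover have "\<rho> z = Suc (rank_of P\<^sub>\<sigma> z)" "rank_of P\<^sub>\<sigma> z \<ge> 1"
    using assms dual_truncation_rank_ge_2[of z] by (simp_all add: rank_of_dual_truncation)
  ultimately show ?thesis by (simp add: chow_weight_def)
qed

lemma top_of_dual_truncation_eq_top_of:
  assumes "z \<in> Field P\<^sub>\<sigma>" "z \<noteq> bot_of P"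
  shows "top_of P\<^sub>\<sigma> = top_of P"
  using dual_truncation_above(1)[OF assms top_greatest] assms
  by (simp add: top_of_dual_truncation Field_dual_truncation)

lemma chow_poly_eq_augmented_dual_truncation: "chow_poly P = augmented_chow_poly P\<^sub>\<sigma>"
proof -
  interpret \<sigma>: bounded_graded_order P\<^sub>\<sigma> by (rule bounded_graded_order_dual_truncation)
  let ?b = "bot_of P" and ?H = "\<lambda>z. chow_interval P\<^sub>\<sigma> z (top_of P\<^sub>\<sigma>)"
  have term_eq: "chow_weight P ?b z * chow_interval P z (top_of P)
      = chow_weight P\<^sub>\<sigma> ?b z * ?H z + monom 1 (rank_of P\<^sub>\<sigma> z) * ?H z"
    if "z \<in> Field P\<^sub>\<sigma> - {?b}" for z
    using that by (simp add: chow_weight_bot_dual_truncation chow_interval_dual_truncation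
        top_of_dual_truncation_eq_top_of[of z] top_greatest Field_dual_truncation distrib_right)
  have "chow_poly P
      = 1 + (\<Sum>z\<in>Field P\<^sub>\<sigma> - {?b}. chow_weight P ?b z * chow_interval P z (top_of P))"
    unfolding chow_poly_recursion by (intro arg_cong[of _ _ "(+) 1"] sum.mono_neutral_right)
      (auto simp: chow_weight_bot_eq_0 Field_dual_truncation)
  also have "\<dots> = 1 + (\<Sum>z\<in>Field P\<^sub>\<sigma> - {?b}. chow_weight P\<^sub>\<sigma> ?b z * ?H z)
      + (\<Sum>z\<in>Field P\<^sub>\<sigma> - {?b}. monom 1 (rank_of P\<^sub>\<sigma> z) * ?H z)"
    by (simp only: term_eq sum.distrib add.assoc cong: sum.cong)
  also have "1 + (\<Sum>z\<in>Field P\<^sub>\<sigma> - {?b}. chow_weight P\<^sub>\<sigma> ?b z * ?H z) = ?H ?b"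
    using \<sigma>.chow_poly_recursion \<sigma>.bot_in_Field
    by (simp add: chow_poly_def chow_weight_def bot_of_dual_truncation
        sum.remove[of "Field P\<^sub>\<sigma>" ?b])
  also have "?H ?b + (\<Sum>z\<in>Field P\<^sub>\<sigma> - {?b}. monom 1 (rank_of P\<^sub>\<sigma> z) * ?H z)
      = augmented_chow_poly P\<^sub>\<sigma>"
    using \<sigma>.bot_in_Field \<sigma>.rank_bot
    by (simp add: augmented_chow_poly_def bot_of_dual_truncation sum.remove[of "Field P\<^sub>\<sigma>" ?b])
  finally show ?thesis .
qed

end

theorem theorem1p2:
  fixes P :: "'a rel"
  assumes "bounded_graded_poset P"
  shows "chow_poly P = augmented_chow_poly (dual_truncation P) \<and>
         augmented_chow_poly (dual_truncation P) = augmented_chow_poly (truncation (P\<inverse>))"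
proof -
  interpret bounded_graded_order P
    using assms by (simp add: bounded_graded_order_iff)
  interpret \<sigma>: bounded_graded_order "dual_truncation P"
    by (rule bounded_graded_order_dual_truncation)
  show ?thesis
    by (simp add: chow_poly_eq_augmented_dual_truncation truncation_converse
        \<sigma>.augmented_chow_poly_converse)
qed

end
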